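(* Let $a\ge 3$ be an integer, let $\rho$ be a root of the polynomial $x^3+(a-1)x^2-ax-1$, and write $a=3A+a_0$ with $A\in\mathbb N_0$ and $a_0\in\{0,1,2\}$. If $\alpha$ is indecomposable in $\mathbb Z[\rho]$, then \[ N(\alpha)\le \begin{cases} 3a^2-3a+1 & \text{if } a\le 4,\\ 4A^3+18A^2+26A+13 & \text{if } a\ge 5 \text{ and } a_0=2,\\ 4A^3+14A^2+16A+7 & \text{if } a\ge 5 \text{ and } a_0=1,\\ 4A^3+10A^2+8A+3 & \text{if } a\ge 5 \text{ and } a_0=0. \end{cases} \]
   Context: The field $K=\mathbb Q(\rho)$ is a totally real cubic field and $\mathbb Z[\rho]$ is an order in it. An element of $K$ is totally positive if all its images under the embeddings $K\to\mathbb R$ are positive. A totally positive $\alpha\in\mathbb Z[\rho]$ is indecomposable in $\mathbb Z[\rho]$ if it cannot be written as $\alpha=\beta+\gamma$ with $\beta,\gamma\in\mathbb Z[\rho]$ totally positive. $N$ denotes the norm from $K$ to $\mathbb Q$. *)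

theory Defs
  imports "HOL-Analysis.Analysis" "HOL-Computational_Algebra.Polynomial"
begin

text \<open>Subrings and subfields of an ambient field of characteristic \<open>0\<close> are represented by their
  underlying sets.\<close>

definition int_adjoin :: "'a::field_char_0 \<Rightarrow> 'a set" where
  "int_adjoin \<rho> = {poly (map_poly of_int p) \<rho> | p :: int poly. True}"

text \<open>If the denominator vanishes, the quotient is \<open>0\<close>, so no extraneous elements arise.\<close>

definition rat_adjoin :: "'a::field_char_0 \<Rightarrow> 'a set" where
  "rat_adjoin \<rho> =
     {poly (map_poly of_rat p) \<rho> / poly (map_poly of_rat q) \<rho> | p q :: rat poly. True}"

text \<open>Field embeddings of \<open>K\<close> into the target type. Extensionality makes distinct functions correspond
  to distinct embeddings, so that products over this set are products over embeddings.
  Injectivity is automatic for unital ring homomorphisms between fields.\<close>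

definition field_embeddings :: "'a::field_char_0 set \<Rightarrow> ('a \<Rightarrow> 'b::field_char_0) set" where
  "field_embeddings K =
     {\<sigma> \<in> extensional K. \<sigma> 1 = 1 \<and>
        (\<forall>x\<in>K. \<forall>y\<in>K. \<sigma> (x + y) = \<sigma> x + \<sigma> y \<and> \<sigma> (x * y) = \<sigma> x * \<sigma> y)}"

definition totally_positive :: "'a::field_char_0 set \<Rightarrow> 'a \<Rightarrow> bool" where
  "totally_positive K \<alpha> \<longleftrightarrow>
     \<alpha> \<in> K \<and> (\<forall>\<sigma> \<in> (field_embeddings K :: ('a \<Rightarrow> real) set). 0 < \<sigma> \<alpha>)"

definition indecomposable_in :: "'a::field_char_0 set \<Rightarrow> 'a set \<Rightarrow> 'a \<Rightarrow> bool" where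
  "indecomposable_in K R \<alpha> \<longleftrightarrow>
     \<alpha> \<in> R \<and> totally_positive K \<alpha> \<and>
     \<not> (\<exists>\<beta>\<in>R. \<exists>\<gamma>\<in>R. totally_positive K \<beta> \<and> totally_positive K \<gamma> \<and> \<alpha> = \<beta> + \<gamma>)"

text \<open>The norm from a number field \<open>K\<close> to the rationals: the product of the images under the
  embeddings into the complex numbers, which is a rational number.\<close>

definition field_norm :: "'a::field_char_0 set \<Rightarrow> 'a \<Rightarrow> rat" where
  "field_norm K \<alpha> =
     (THE q. of_rat q = (\<Prod>\<sigma> \<in> (field_embeddings K :: ('a \<Rightarrow> complex) set). \<sigma> \<alpha>))"

end

theory Submission
  imports Defs "HOL-Computational_Algebra.Polynomial_Factorial" "HOL-Computational_Algebra.Field_as_Ring"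
begin

text \<open>The polynomial is \<open>x(x - 1)(x + a) - 1\<close>, so \<open>\<rho>\<close>, \<open>\<rho> - 1\<close> and \<open>\<rho> + a\<close> are units. Up to the totally
  positive units generated by \<open>\<rho> + a\<close> and \<open>1 + a\<rho> + \<rho>\<^sup>2\<close>, every totally positive element of the order
  lies in the cone over \<open>1, \<rho>\<^sup>2 - \<rho>, \<rho>\<^sup>2\<close> or in the cone over \<open>1, 1 + a\<rho> + \<rho>\<^sup>2, \<rho>\<^sup>2\<close>: these are cones over
  facets of the convex hull of the totally positive units, and among the linear functionals
  equal to \<open>1\<close> on the various facets, the one that is smallest at a given point belongs to a facet
  whose cone contains the point. The first cone is unimodular and the second has index \<open>a\<close>, so
  the indecomposables are, up to units, \<open>1\<close> and \<open>1 + j\<rho> + \<rho>\<^sup>2\<close> with \<open>0 < j < a\<close>. The norm of the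
  latter is a cubic polynomial in \<open>j\<close>, which remains to be maximised over the integers.\<close>

subsection \<open>Embeddings of a simple extension of the rationals\<close>

definition rat_poly :: "rat poly \<Rightarrow> 'a::field_char_0 \<Rightarrow> 'a" where
  "rat_poly p = poly (map_poly of_rat p)"

lemma rat_poly_add: "rat_poly (p + q) x = rat_poly p x + rat_poly q x"
proof -
  have "map_poly of_rat (p + q) = (map_poly of_rat p + map_poly of_rat q :: 'a poly)"
    by (intro poly_eqI) (simp add: coeff_map_poly of_rat_add)
  then show ?thesis by (simp add: rat_poly_def)
qed

lemma rat_poly_mult: "rat_poly (p * q) x = rat_poly p x * rat_poly q x"
proof -
  have "map_poly of_rat (p * q) = (map_poly of_rat p * map_poly of_rat q :: 'a poly)"
    by (intro poly_eqI) (simp add: coeff_map_poly coeff_mult of_rat_mult of_rat_sum)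
  then show ?thesis by (simp add: rat_poly_def)
qed

lemma rat_poly_diff: "rat_poly (p - q) x = rat_poly p x - rat_poly q x"
  using rat_poly_add[of "p - q" q x] by simp

lemma rat_poly_0 [simp]: "rat_poly 0 x = 0"
  and rat_poly_1 [simp]: "rat_poly 1 x = 1"
  and rat_poly_pCons [simp]: "rat_poly (pCons c p) x = of_rat c + x * rat_poly p x"
  by (simp_all add: rat_poly_def map_poly_pCons)

lemma rat_adjoin_altdef:
  "rat_adjoin \<rho> = {rat_poly p \<rho> / rat_poly q \<rho> | p q. True}"
  by (simp add: rat_adjoin_def rat_poly_def)

text \<open>A quotient with vanishing denominator is 0, which is also the quotient of
  \<open>0\<close> by \<open>1\<close>.\<close>

lemma rat_adjoin_cases:
  assumes "x \<in> rat_adjoin \<rho>"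
  obtains p q where "x = rat_poly p \<rho> / rat_poly q \<rho>" "rat_poly q \<rho> \<noteq> 0"
proof -
  obtain p q where x: "x = rat_poly p \<rho> / rat_poly q \<rho>"
    using assms by (auto simp: rat_adjoin_altdef)
  show ?thesis
  proof (cases "rat_poly q \<rho> = 0")
    case True
    then show ?thesis using x that[of 0 1] by simp
  next
    case False
    then show ?thesis using x that by blast
  qed
qed

lemma rat_poly_in_rat_adjoin [simp]: "rat_poly p \<rho> \<in> rat_adjoin \<rho>"
proof -
  have "rat_poly p \<rho> = rat_poly p \<rho> / rat_poly 1 \<rho>" by simp
  then show ?thesis unfolding rat_adjoin_altdef by blast
qed

lemma gen_in_rat_adjoin: "\<rho> \<in> rat_adjoin \<rho>"
  using rat_poly_in_rat_adjoin[of "[:0, 1:]" \<rho>] by simp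

lemma rat_adjoin_closed:
  assumes "x \<in> rat_adjoin \<rho>" "y \<in> rat_adjoin \<rho>"
  shows "x + y \<in> rat_adjoin \<rho>" "x * y \<in> rat_adjoin \<rho>"
proof -
  obtain p q where x: "x = rat_poly p \<rho> / rat_poly q \<rho>" "rat_poly q \<rho> \<noteq> 0"
    using assms(1) by (rule rat_adjoin_cases)
  obtain p' q' where y: "y = rat_poly p' \<rho> / rat_poly q' \<rho>" "rat_poly q' \<rho> \<noteq> 0"
    using assms(2) by (rule rat_adjoin_cases)
  have "x + y = rat_poly (p * q' + p' * q) \<rho> / rat_poly (q * q') \<rho>"
    using x y by (simp add: rat_poly_add rat_poly_mult add_frac_eq)
  then show "x + y \<in> rat_adjoin \<rho>" unfolding rat_adjoin_altdef by blast
  have "x * y = rat_poly (p * p') \<rho> / rat_poly (q * q') \<rho>"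
    using x y by (simp add: rat_poly_mult)
  then show "x * y \<in> rat_adjoin \<rho>" unfolding rat_adjoin_altdef by blast
qed

text \<open>Additivity, multiplicativity and \<open>\<sigma> 1 = 1\<close> force
  \<open>\<sigma>\<close> to fix the naturals, then the integers, then the rationals; induction
  along Horner's scheme does the rest.\<close>

lemma embedding_rat_poly:
  fixes \<rho> :: "'a::field_char_0" and \<sigma> :: "'a \<Rightarrow> 'b::field_char_0"
  assumes "\<sigma> \<in> field_embeddings (rat_adjoin \<rho>)"
  shows "\<sigma> (rat_poly p \<rho>) = rat_poly p (\<sigma> \<rho>)"
proof -
  let ?K = "rat_adjoin \<rho>"
  have one: "\<sigma> 1 = 1"
    and add: "\<And>x y. x \<in> ?K \<Longrightarrow> y \<in> ?K \<Longrightarrow> \<sigma> (x + y) = \<sigma> x + \<sigma> y"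
    and mult: "\<And>x y. x \<in> ?K \<Longrightarrow> y \<in> ?K \<Longrightarrow> \<sigma> (x * y) = \<sigma> x * \<sigma> y"
    using assms by (auto simp: field_embeddings_def)
  have rat: "of_rat c \<in> ?K" for c
    using rat_poly_in_rat_adjoin[of "[:c:]" \<rho>] by simp
  have int: "of_int k \<in> ?K" for k
    using rat[of "of_int k"] by simp
  have nat: "of_nat n \<in> ?K" for n
    using int[of "int n"] by simp
  have K0: "0 \<in> ?K" and K1: "1 \<in> ?K" using nat[of 0] nat[of 1] by auto
  have zero: "\<sigma> 0 = 0" using add[OF K0 K0] by simp
  have \<sigma>_nat: "\<sigma> (of_nat n) = of_nat n" for n
    by (induction n) (simp_all add: zero one add[OF K1 nat])
  have \<sigma>_int: "\<sigma> (of_int k) = of_int k" for k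
  proof (cases k)
    case (nonneg n)
    then show ?thesis using \<sigma>_nat by simp
  next
    case (neg n)
    have "0 = \<sigma> (of_int k + of_nat (Suc n))" using neg zero by simp
    also have "\<dots> = \<sigma> (of_int k) + of_nat (Suc n)"
      by (simp only: add[OF int nat] \<sigma>_nat)
    finally have "\<sigma> (of_int k) = - of_nat (Suc n)" by (simp only: eq_neg_iff_add_eq_0)
    then show ?thesis using neg by simp
  qed
  have \<sigma>_rat: "\<sigma> (of_rat c) = of_rat c" for c
  proof -
    obtain m n where c: "c = of_int m / of_int n" "n > 0"
      using quotient_of_div[of c] quotient_of_denom_pos'[of c] by (metis surj_pair snd_conv)
    have "of_int m = \<sigma> (of_rat c * of_int n)"
      using c \<sigma>_int by (simp add: of_rat_divide)
    also have "\<dots> = \<sigma> (of_rat c) * of_int n"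
      using mult[OF rat int] \<sigma>_int by simp
    finally have "\<sigma> (of_rat c) = of_int m / of_int n" using c(2) by (simp add: field_simps)
    then show ?thesis by (simp add: c(1) of_rat_divide)
  qed
  show ?thesis
  proof (induction p)
    case 0
    then show ?case using zero by simp
  next
    case (pCons c p)
    have "\<rho> * rat_poly p \<rho> \<in> ?K"
      using gen_in_rat_adjoin rat_poly_in_rat_adjoin by (rule rat_adjoin_closed)
    then show ?case
      by (simp add: add[OF rat] mult[OF gen_in_rat_adjoin] \<sigma>_rat pCons.IH)
  qed
qed

lemma embedding_quotient:
  fixes \<rho> :: "'a::field_char_0" and \<sigma> :: "'a \<Rightarrow> 'b::field_char_0"
  assumes "\<sigma> \<in> field_embeddings (rat_adjoin \<rho>)" "rat_poly q \<rho> \<noteq> 0"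
  shows "\<sigma> (rat_poly p \<rho> / rat_poly q \<rho>) = rat_poly p (\<sigma> \<rho>) / rat_poly q (\<sigma> \<rho>)"
proof -
  let ?K = "rat_adjoin \<rho>"
  have one: "\<sigma> 1 = 1"
    and mult: "\<And>x y. x \<in> ?K \<Longrightarrow> y \<in> ?K \<Longrightarrow> \<sigma> (x * y) = \<sigma> x * \<sigma> y"
    using assms by (auto simp: field_embeddings_def)
  have mem: "rat_poly r \<rho> / rat_poly q \<rho> \<in> ?K" for r
    unfolding rat_adjoin_altdef by blast
  have quot: "\<sigma> (rat_poly r \<rho> / rat_poly q \<rho>) * rat_poly q (\<sigma> \<rho>) = rat_poly r (\<sigma> \<rho>)" for r
  proof -
    have "\<sigma> (rat_poly r \<rho> / rat_poly q \<rho>) * \<sigma> (rat_poly q \<rho>) = \<sigma> (rat_poly r \<rho>)"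
      using assms(2) by (simp flip: mult[OF mem])
    then show ?thesis by (simp add: embedding_rat_poly[OF assms(1)])
  qed
  \<comment> \<open>The numerator \<open>1\<close> exhibits an inverse of the image of the
    denominator.\<close>
  have "rat_poly q (\<sigma> \<rho>) \<noteq> 0" using quot[of 1] by auto
  then show ?thesis using quot[of p] by (simp add: field_simps)
qed

lemma embedding_eqI:
  fixes \<rho> :: "'a::field_char_0" and \<sigma> \<tau> :: "'a \<Rightarrow> 'b::field_char_0"
  assumes "\<sigma> \<in> field_embeddings (rat_adjoin \<rho>)" "\<tau> \<in> field_embeddings (rat_adjoin \<rho>)"
    and "\<sigma> \<rho> = \<tau> \<rho>"
  shows "\<sigma> = \<tau>"
proof (rule extensionalityI[of _ "rat_adjoin \<rho>"])
  fix x assume "x \<in> rat_adjoin \<rho>"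
  then obtain p q where "x = rat_poly p \<rho> / rat_poly q \<rho>" "rat_poly q \<rho> \<noteq> 0"
    by (rule rat_adjoin_cases)
  then show "\<sigma> x = \<tau> x" using assms by (simp add: embedding_quotient)
qed (use assms in \<open>auto simp: field_embeddings_def\<close>)

text \<open>Otherwise \<open>f\<close> and \<open>p\<close> are coprime over the rationals, and a
  Bezout identity evaluated at \<open>x\<close> reads 0 = 1.\<close>

lemma irreducible_dvd_of_common_root:
  fixes x :: "'a::field_char_0"
  assumes "irreducible f" "rat_poly f x = 0" "rat_poly p x = 0"
  shows "f dvd p"
proof (rule ccontr)
  assume "\<not> f dvd p"
  then have "coprime f p"
    using assms(1) irreducible_imp_prime_elem prime_elem_imp_coprime by blast
  then obtain u v where "u * f + v * p = 1"
    by (metis bezout_coefficients_fst_snd coprime_imp_gcd_eq_1)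
  then have "rat_poly (u * f + v * p) x = (1 :: 'a)" by simp
  then show False using assms(2,3) by (simp add: rat_poly_add rat_poly_mult)
qed

text \<open>Each quotient is evaluated at \<open>r\<close> instead of \<open>\<rho>\<close>. The
  rational polynomials vanishing at \<open>\<rho>\<close> and at \<open>r\<close> are the same,
  namely the multiples of \<open>f\<close>, so the value does not depend on the chosen
  quotient.\<close>

lemma embedding_exists:
  fixes \<rho> :: "'a::field_char_0" and r :: "'b::field_char_0"
  assumes irr: "irreducible f" and root: "rat_poly f \<rho> = 0" "rat_poly f r = 0"
  obtains \<sigma> where "\<sigma> \<in> field_embeddings (rat_adjoin \<rho>)" "\<sigma> \<rho> = r"
proof -
  let ?K = "rat_adjoin \<rho>"
  have zero_iff: "rat_poly p \<rho> = 0 \<longleftrightarrow> rat_poly p r = 0" for p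
    using irreducible_dvd_of_common_root[OF irr root(1), of p]
      irreducible_dvd_of_common_root[OF irr root(2), of p] root
    by (auto simp: dvd_def rat_poly_mult)
  define rel where "rel x y \<longleftrightarrow>
    (\<exists>p q. rat_poly q \<rho> \<noteq> 0 \<and> x = rat_poly p \<rho> / rat_poly q \<rho> \<and> y = rat_poly p r / rat_poly q r)"
    for x and y :: 'b
  define \<sigma> where "\<sigma> = restrict (\<lambda>x. SOME y. rel x y) ?K"
  have uniq: "y = y'" if xy: "rel x y" "rel x y'" for x y y'
  proof -
    obtain p q where 1: "rat_poly q \<rho> \<noteq> 0" "x = rat_poly p \<rho> / rat_poly q \<rho>"
      "y = rat_poly p r / rat_poly q r" using xy(1) unfolding rel_def by blast
    obtain p' q' where 2: "rat_poly q' \<rho> \<noteq> 0" "x = rat_poly p' \<rho> / rat_poly q' \<rho>"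
      "y' = rat_poly p' r / rat_poly q' r" using xy(2) unfolding rel_def by blast
    have "rat_poly (p * q' - p' * q) \<rho> = 0"
      using 1 2 by (simp add: rat_poly_diff rat_poly_mult field_simps)
    then have "rat_poly (p * q' - p' * q) r = 0" by (simp add: zero_iff)
    then have "rat_poly p r * rat_poly q' r = rat_poly p' r * rat_poly q r"
      by (simp add: rat_poly_diff rat_poly_mult)
    moreover have "rat_poly q r \<noteq> 0" "rat_poly q' r \<noteq> 0" using 1 2 zero_iff by auto
    ultimately show ?thesis using 1 2 by (simp add: frac_eq_eq)
  qed
  have \<sigma>_eq: "\<sigma> x = y" if "rel x y" for x y
  proof -
    have "x \<in> ?K" using that unfolding rel_def rat_adjoin_altdef by blast
    moreover have "rel x (SOME y. rel x y)" using that by (rule someI)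
    ultimately show ?thesis using uniq that by (simp add: \<sigma>_def)
  qed
  have ex: "\<exists>y. rel x y" if "x \<in> ?K" for x
    using that unfolding rel_def by (metis rat_adjoin_cases)
  have rel_1: "rel 1 1" unfolding rel_def by (rule exI[of _ 1], rule exI[of _ 1]) simp
  have rel_add: "rel (x + x') (y + y')" and rel_mult: "rel (x * x') (y * y')" if xy: "rel x y" "rel x' y'" for x x' y y'
  proof -
    obtain p q where 1: "rat_poly q \<rho> \<noteq> 0" "x = rat_poly p \<rho> / rat_poly q \<rho>"
      "y = rat_poly p r / rat_poly q r" using xy(1) unfolding rel_def by blast
    obtain p' q' where 2: "rat_poly q' \<rho> \<noteq> 0" "x' = rat_poly p' \<rho> / rat_poly q' \<rho>"
      "y' = rat_poly p' r / rat_poly q' r" using xy(2) unfolding rel_def by blast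
    have nz: "rat_poly q r \<noteq> 0" "rat_poly q' r \<noteq> 0" using 1 2 zero_iff by auto
    show "rel (x + x') (y + y')" unfolding rel_def
      using 1 2 nz
      by (intro exI[of _ "p * q' + p' * q"] exI[of _ "q * q'"])
        (simp add: rat_poly_add rat_poly_mult add_frac_eq)
    show "rel (x * x') (y * y')" unfolding rel_def
      using 1 2 nz by (intro exI[of _ "p * p'"] exI[of _ "q * q'"]) (simp add: rat_poly_mult)
  qed
  have hom: "\<sigma> (x + x') = \<sigma> x + \<sigma> x' \<and> \<sigma> (x * x') = \<sigma> x * \<sigma> x'"
    if xx': "x \<in> ?K" "x' \<in> ?K" for x x'
  proof -
    obtain y y' where y: "rel x y" "rel x' y'" using ex[OF xx'(1)] ex[OF xx'(2)] by blast
    show ?thesis using \<sigma>_eq[OF rel_add[OF y]] \<sigma>_eq[OF rel_mult[OF y]] y \<sigma>_eq by simp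
  qed
  have "\<sigma> \<in> extensional ?K" by (simp add: \<sigma>_def)
  then have "\<sigma> \<in> field_embeddings ?K"
    using hom \<sigma>_eq[OF rel_1] by (simp add: field_embeddings_def)
  moreover have "rel \<rho> r"
    unfolding rel_def by (rule exI[of _ "[:0, 1:]"], rule exI[of _ 1]) simp
  ultimately show ?thesis using that \<sigma>_eq by blast
qed

lemma field_norm_eqI:
  assumes "(\<Prod>\<sigma> \<in> (field_embeddings K :: ('a::field_char_0 \<Rightarrow> complex) set). \<sigma> \<alpha>) = of_rat q"
  shows "field_norm K \<alpha> = q"
  unfolding field_norm_def using assms by (intro the_equality) simp_all

text \<open>The target field stays arbitrary because the reals serve total positivity and the
  complex numbers serve the norm.\<close>

lemma bij_betw_embeddings_roots:
  fixes \<rho> :: "'a::field_char_0"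
  assumes "irreducible f" "rat_poly f \<rho> = 0"
  shows "bij_betw (\<lambda>\<sigma>. \<sigma> \<rho>) (field_embeddings (rat_adjoin \<rho>) :: ('a \<Rightarrow> 'b::field_char_0) set)
    {t. rat_poly f t = 0}"
proof (rule bij_betwI')
  fix \<sigma> \<tau> :: "'a \<Rightarrow> 'b"
  assume "\<sigma> \<in> field_embeddings (rat_adjoin \<rho>)" "\<tau> \<in> field_embeddings (rat_adjoin \<rho>)"
  then show "\<sigma> \<rho> = \<tau> \<rho> \<longleftrightarrow> \<sigma> = \<tau>" using embedding_eqI by blast
next
  fix \<sigma> :: "'a \<Rightarrow> 'b"
  assume \<sigma>: "\<sigma> \<in> field_embeddings (rat_adjoin \<rho>)"
  have "\<sigma> 0 = 0" using embedding_rat_poly[OF \<sigma>, of 0] by simp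
  then show "\<sigma> \<rho> \<in> {t. rat_poly f t = 0}"
    using embedding_rat_poly[OF \<sigma>, of f] assms(2) by simp
next
  fix t :: 'b
  assume "t \<in> {t. rat_poly f t = 0}"
  then have "rat_poly f t = 0" by simp
  then obtain \<sigma> where "\<sigma> \<in> field_embeddings (rat_adjoin \<rho>)" "\<sigma> \<rho> = t"
    by (rule embedding_exists[OF assms])
  then show "\<exists>\<sigma>\<in>field_embeddings (rat_adjoin \<rho>). t = \<sigma> \<rho>" by blast
qed

subsection \<open>Indecomposables and units\<close>

lemma int_adjoin_subset_rat_adjoin: "int_adjoin \<rho> \<subseteq> rat_adjoin \<rho>"
proof -
  have "poly (map_poly of_int p) \<rho> = rat_poly (map_poly of_int p) \<rho>" for p :: "int poly"
    unfolding rat_poly_def by (subst map_poly_map_poly) (simp_all add: o_def)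
  then show ?thesis unfolding int_adjoin_def using rat_poly_in_rat_adjoin by fastforce
qed

lemma int_adjoin_mult:
  fixes x y :: "'a::field_char_0"
  assumes "x \<in> int_adjoin \<rho>" "y \<in> int_adjoin \<rho>"
  shows "x * y \<in> int_adjoin \<rho>"
proof -
  obtain p q where "x = poly (map_poly of_int p) \<rho>" "y = poly (map_poly of_int q) \<rho>"
    using assms by (auto simp: int_adjoin_def)
  moreover have "map_poly of_int (p * q) = (map_poly of_int p * map_poly of_int q :: 'a poly)"
    by (intro poly_eqI) (simp add: coeff_map_poly coeff_mult)
  ultimately have "x * y = poly (map_poly of_int (p * q)) \<rho>" by simp
  then show ?thesis unfolding int_adjoin_def by blast
qed

lemma embedding_mult:
  assumes "\<sigma> \<in> field_embeddings K" "x \<in> K" "y \<in> K"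
  shows "\<sigma> (x * y) = \<sigma> x * \<sigma> y"
  using assms by (auto simp: field_embeddings_def)

lemma totally_positive_mult:
  assumes "totally_positive (rat_adjoin \<rho>) x" "totally_positive (rat_adjoin \<rho>) y"
  shows "totally_positive (rat_adjoin \<rho>) (x * y)"
  using assms rat_adjoin_closed by (auto simp: totally_positive_def embedding_mult)

lemma totally_positive_inverse:
  assumes "totally_positive (rat_adjoin \<rho>) u" "v \<in> rat_adjoin \<rho>" "u * v = 1"
  shows "totally_positive (rat_adjoin \<rho>) v"
  unfolding totally_positive_def
proof (intro conjI ballI)
  fix \<sigma> :: "'a \<Rightarrow> real" assume \<sigma>: "\<sigma> \<in> field_embeddings (rat_adjoin \<rho>)"
  have "u \<in> rat_adjoin \<rho>" "0 < \<sigma> u" using assms \<sigma> by (auto simp: totally_positive_def)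
  moreover have "\<sigma> u * \<sigma> v = 1"
    using embedding_mult[OF \<sigma>, of u v] calculation assms(2,3) \<sigma>
    by (simp add: field_embeddings_def)
  ultimately show "0 < \<sigma> v" by (metis zero_less_mult_pos zero_less_one)
qed fact

text \<open>Multiplication by the inverse \<open>v\<close>, itself totally positive, turns a
  decomposition of \<open>u * \<alpha>\<close> into one of \<open>\<alpha>\<close>.\<close>

lemma indecomposable_in_mult_unit:
  assumes "indecomposable_in (rat_adjoin \<rho>) (int_adjoin \<rho>) \<alpha>"
    and u: "u \<in> int_adjoin \<rho>" "totally_positive (rat_adjoin \<rho>) u"
    and v: "v \<in> int_adjoin \<rho>" "u * v = 1"
  shows "indecomposable_in (rat_adjoin \<rho>) (int_adjoin \<rho>) (u * \<alpha>)"
  unfolding indecomposable_in_def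
proof (intro conjI notI)
  show "u * \<alpha> \<in> int_adjoin \<rho>" "totally_positive (rat_adjoin \<rho>) (u * \<alpha>)"
    using assms by (auto simp: indecomposable_in_def int_adjoin_mult totally_positive_mult)
next
  assume "\<exists>\<beta>\<in>int_adjoin \<rho>. \<exists>\<gamma>\<in>int_adjoin \<rho>. totally_positive (rat_adjoin \<rho>) \<beta> \<and>
    totally_positive (rat_adjoin \<rho>) \<gamma> \<and> u * \<alpha> = \<beta> + \<gamma>"
  then obtain \<beta> \<gamma> where \<beta>\<gamma>: "\<beta> \<in> int_adjoin \<rho>" "\<gamma> \<in> int_adjoin \<rho>"
    "totally_positive (rat_adjoin \<rho>) \<beta>" "totally_positive (rat_adjoin \<rho>) \<gamma>" "u * \<alpha> = \<beta> + \<gamma>"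
    by blast
  have tv: "totally_positive (rat_adjoin \<rho>) v"
    using totally_positive_inverse u(2) v int_adjoin_subset_rat_adjoin by blast
  have "\<alpha> = v * (u * \<alpha>)" using v(2) by (simp add: mult.assoc[symmetric] mult.commute[of v])
  then have "\<alpha> = v * \<beta> + v * \<gamma>" using \<beta>\<gamma>(5) by (simp add: distrib_left)
  moreover have "v * \<beta> \<in> int_adjoin \<rho>" "v * \<gamma> \<in> int_adjoin \<rho>"
    "totally_positive (rat_adjoin \<rho>) (v * \<beta>)" "totally_positive (rat_adjoin \<rho>) (v * \<gamma>)"
    using \<beta>\<gamma> v tv by (simp_all add: int_adjoin_mult totally_positive_mult)
  ultimately show False
    using assms(1) unfolding indecomposable_in_def by blast
qed

text \<open>The third assumption makes both norms definite descriptions of the same complex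
  number.\<close>

lemma field_norm_mult_unit:
  assumes "u \<in> K" "\<alpha> \<in> K"
    and "(\<Prod>\<sigma> \<in> (field_embeddings K :: ('a::field_char_0 \<Rightarrow> complex) set). \<sigma> u) = 1"
  shows "field_norm K (u * \<alpha>) = field_norm K \<alpha>"
proof -
  have "(\<Prod>\<sigma> \<in> (field_embeddings K :: ('a \<Rightarrow> complex) set). \<sigma> (u * \<alpha>)) =
      (\<Prod>\<sigma> \<in> (field_embeddings K :: ('a \<Rightarrow> complex) set). \<sigma> u * \<sigma> \<alpha>)"
    using assms by (intro prod.cong) (simp_all add: embedding_mult)
  then show ?thesis using assms(3) by (simp add: field_norm_def prod.distrib)
qed

subsection \<open>The cubic polynomial\<close>

text \<open>A factorisation of a cubic into two non-units has a linear factor, which would supply a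
  root.\<close>

lemma irreducible_cubic:
  fixes f :: "'a::field poly"
  assumes "degree f = 3" "\<And>x. poly f x \<noteq> 0"
  shows "irreducible f"
proof (rule irreducibleI)
  show "f \<noteq> 0" using assms(1) by auto
  then show "\<not> f dvd 1" using assms(1) by (simp add: is_unit_iff_degree)
next
  fix g h assume fgh: "f = g * h"
  have nz: "g \<noteq> 0" "h \<noteq> 0" using assms(1) fgh by auto
  then have deg: "degree g + degree h = 3" using assms(1) fgh by (simp add: degree_mult_eq)
  have no_linear: "degree k \<noteq> 1" if "k dvd f" for k
  proof
    assume "degree k = 1"
    then obtain b k' where "k = pCons b k'" "k' \<noteq> 0" "degree k' = 0"
      by (cases k) (auto simp: degree_pCons_eq_if split: if_splits)
    then obtain c where "k = [:b, c:]" "c \<noteq> 0" by (auto elim: degree_eq_zeroE)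
    then have "poly k (- b / c) = 0" by simp
    then show False using assms(2) that by (auto elim!: dvdE)
  qed
  have "degree g \<noteq> 1" "degree h \<noteq> 1" using no_linear fgh by auto
  with deg have "degree g = 0 \<or> degree h = 0" by arith
  then show "g dvd 1 \<or> h dvd 1" using nz by (auto simp: is_unit_iff_degree)
qed

text \<open>Parity decides. For \<open>s = p / q\<close> in lowest terms,
  \<open>p * (p - q) * (p + a * q) = q^3\<close>. If \<open>q\<close> is even, then \<open>p\<close>
  is odd and so is the left side; if \<open>q\<close> is odd, then \<open>p\<close> or
  \<open>p - q\<close> is even.\<close>

lemma no_rational_root: "s * (s - 1) * (s + of_int a) \<noteq> (1 :: rat)"
proof
  assume eq: "s * (s - 1) * (s + of_int a) = 1"
  obtain p q where "quotient_of s = (p, q)" by force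
  then have s: "s = of_int p / of_int q" "q > 0" "coprime p q"
    using quotient_of_div quotient_of_denom_pos quotient_of_coprime by blast+
  have "rat_of_int (p * (p - q) * (p + a * q)) = of_int (q * q * q)"
  proof -
    have p: "rat_of_int p = s * of_int q" using s(1,2) by simp
    have "rat_of_int (p * (p - q) * (p + a * q)) =
        s * (s - 1) * (s + of_int a) * of_int (q * q * q)"
      by (simp add: p algebra_simps)
    then show ?thesis using eq by simp
  qed
  then have "p * (p - q) * (p + a * q) = q * q * q" by (simp only: of_int_eq_iff)
  then have "even (p * (p - q) * (p + a * q)) \<longleftrightarrow> even (q * q * q)" by simp
  moreover have "odd p \<or> odd q" using s(3) coprime_common_divisor[of p q 2] by auto
  ultimately show False by auto
qed

text \<open>The cubic changes sign on each of the three intervals, and its values at their endpoints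
  are nonzero.\<close>

lemma real_roots:
  fixes a :: real
  assumes "a \<ge> 3"
  obtains r s t where "1 < r" "r < 2" "-1 < s" "s < 0" "- a < t" "t < 1 - a"
    "r + s + t = 1 - a" "r * s + r * t + s * t = - a" "r * s * t = 1"
proof -
  define f where "f x = x * (x - 1) * (x + a) - 1" for x :: real
  have cont: "continuous_on S f" for S unfolding f_def by (intro continuous_intros)
  have val: "f (- a) < 0" "f (1 - a) > 0" "f (-1) > 0" "f 0 < 0" "f 1 < 0" "f 2 > 0"
  proof -
    have "f (1 - a) = a * (a - 1) - 1" by (simp add: f_def algebra_simps)
    moreover have "a * (a - 1) \<ge> 3 * 2" using assms by (intro mult_mono) auto
    ultimately show "f (1 - a) > 0" by simp
  qed (use assms in \<open>simp_all add: f_def\<close>)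
  obtain r where r: "1 \<le> r" "r \<le> 2" "f r = 0"
    using IVT'[of f 1 0 2] val cont by force
  obtain s where s: "-1 \<le> s" "s \<le> 0" "f s = 0"
    using IVT2'[of f 0 0 "-1"] val cont by force
  obtain t where t: "- a \<le> t" "t \<le> 1 - a" "f t = 0"
    using IVT'[of f "- a" 0 "1 - a"] val cont by force
  have "r \<noteq> 1" "r \<noteq> 2" "s \<noteq> -1" "s \<noteq> 0" "t \<noteq> - a" "t \<noteq> 1 - a"
    using val r(3) s(3) t(3) by auto
  then have bounds: "1 < r" "r < 2" "-1 < s" "s < 0" "- a < t" "t < 1 - a"
    using r s t by auto
  \<comment> \<open>Divided differences of \<open>f\<close> vanish at pairs of distinct roots.
    Subtracting two of them and cancelling \<open>s - t\<close> gives the sum of the roots; the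
    other Vieta relations follow.\<close>
  have "(r - s) * (r^2 + r * s + s^2 + (a - 1) * (r + s) - a) = f r - f s"
    "(r - t) * (r^2 + r * t + t^2 + (a - 1) * (r + t) - a) = f r - f t"
    by (simp_all add: f_def algebra_simps power2_eq_square)
  then have quad: "r^2 + r * s + s^2 + (a - 1) * (r + s) - a = 0"
    "r^2 + r * t + t^2 + (a - 1) * (r + t) - a = 0"
    using bounds r(3) s(3) t(3) assms by auto
  have "(s - t) * (r + s + t - (1 - a)) =
      (r^2 + r * s + s^2 + (a - 1) * (r + s) - a) - (r^2 + r * t + t^2 + (a - 1) * (r + t) - a)"
    by (simp add: algebra_simps power2_eq_square)
  then have e1: "r + s + t = 1 - a" using quad bounds assms by simp
  have "r * s + r * t + s * t = - (r^2 + r * s + s^2 + (a - 1) * (r + s) - a) + (r + s) * (r + s + t - (1 - a)) - a"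
    by (simp add: algebra_simps power2_eq_square)
  then have e2: "r * s + r * t + s * t = - a" using e1 quad by simp
  have "r * s * t = f r + 1 - r^2 * (r + s + t - (1 - a)) + r * (r * s + r * t + s * t - (- a))"
    by (simp add: f_def algebra_simps power2_eq_square)
  then have e3: "r * s * t = 1" using e1 e2 r(3) by simp
  show ?thesis using that bounds e1 e2 e3 .
qed

subsection \<open>The order generated by a root\<close>

text \<open>Coordinates in the power basis. With \<open>\<theta>\<close> as a parameter, one integer
  triple names an element of the order and, at the other roots, its conjugates.\<close>

definition elt :: "'a::comm_ring_1 \<Rightarrow> int \<Rightarrow> int \<Rightarrow> int \<Rightarrow> 'a" where
  "elt \<theta> x y z = of_int x + of_int y * \<theta> + of_int z * \<theta>^2"

lemma elt_diff: "elt \<theta> x y z - elt \<theta> x' y' z' = elt \<theta> (x - x') (y - y') (z - z')"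
  by (simp add: elt_def algebra_simps)

lemma elt_of_real: "elt (of_real \<theta> :: 'a::{real_algebra_1,comm_ring_1}) x y z = of_real (elt \<theta> x y z)"
  by (simp add: elt_def)

lemma elt_in_int_adjoin: "elt \<theta> x y z \<in> int_adjoin \<theta>"
proof -
  have "elt \<theta> x y z = poly (map_poly of_int [:x, y, z:]) \<theta>"
    by (simp add: elt_def map_poly_pCons algebra_simps power2_eq_square)
  then show ?thesis unfolding int_adjoin_def by blast
qed

lemma embedding_elt:
  assumes "\<sigma> \<in> field_embeddings (rat_adjoin \<theta>)"
  shows "\<sigma> (elt \<theta> x y z) = elt (\<sigma> \<theta>) x y z"
proof -
  have "elt t x y z = rat_poly [:of_int x, of_int y, of_int z:] t" for t :: "'c::field_char_0"
    by (simp add: elt_def algebra_simps power2_eq_square)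
  then show ?thesis using embedding_rat_poly[OF assms] by metis
qed

text \<open>The multipliers are the root, the units \<open>\<theta> + a\<close> and
  \<open>1 + a * \<theta> + \<theta>^2\<close>, and then their inverses in the same order. In each
  formula the two sides differ by a multiple of the cubic.\<close>

lemma elt_mult:
  fixes \<theta> :: "'a::comm_ring_1"
  assumes "\<theta> * (\<theta> - 1) * (\<theta> + of_int a) = 1"
  shows "\<theta> * elt \<theta> x y z = elt \<theta> z (x + a * z) (y - (a - 1) * z)" (is "?l1 = ?r1")
    and "elt \<theta> a 1 0 * elt \<theta> x y z = elt \<theta> (a * x + z) (x + a * y + a * z) (y + z)" (is "?l2 = ?r2")
    and "elt \<theta> 1 a 1 * elt \<theta> x y z =
      elt \<theta> (x + y + z) (a * x + (a + 1) * (y + z)) (x + y + 2 * z)" (is "?l3 = ?r3")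
    and "elt \<theta> 0 (-1) 1 * elt \<theta> x y z =
      elt \<theta> (y - a * z) (a * y - x + (1 - a^2) * z) (x - a * y + a^2 * z)" (is "?l4 = ?r4")
    and "elt \<theta> (1 + a) (1 - a) (-1) * elt \<theta> x y z =
      elt \<theta> (x - y + a * x) (y - z - (a - 1) * x) (z - x)" (is "?l5 = ?r5")
proof -
  let ?f = "\<theta> * (\<theta> - 1) * (\<theta> + of_int a) - 1"
  have "?l1 - ?r1 = of_int z * ?f" "?l2 - ?r2 = of_int z * ?f"
    "?l3 - ?r3 = (of_int z * \<theta> + of_int (y + z)) * ?f"
    "?l4 - ?r4 = (of_int z * \<theta> + of_int (y - a * z)) * ?f"
    "?l5 - ?r5 = - (of_int z * \<theta> + of_int y) * ?f"
    by (simp_all add: elt_def algebra_simps power2_eq_square)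
  then show "?l1 = ?r1" "?l2 = ?r2" "?l3 = ?r3" "?l4 = ?r4" "?l5 = ?r5"
    using assms by simp_all
qed

text \<open>The family is that of Ennola's cubic fields. The real roots are parameters so that
  conjugates become explicit real numbers.\<close>

locale ennola =
  fixes a :: int and \<rho> :: "'a::field_char_0" and r s t :: real
  assumes a_ge_3: "a \<ge> 3"
    and root: "\<rho> * (\<rho> - 1) * (\<rho> + of_int a) = 1"
    and bounds: "1 < r" "r < 2" "-1 < s" "s < 0" "- of_int a < t" "t < 1 - of_int a"
    and vieta: "r + s + t = 1 - of_int a" "r * s + r * t + s * t = - of_int a" "r * s * t = 1"
begin

abbreviation "K \<equiv> rat_adjoin \<rho>"
abbreviation "R \<equiv> int_adjoin \<rho>"
abbreviation "indec x y z \<equiv> indecomposable_in K R (elt \<rho> x y z)"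
abbreviation "tpos x y z \<equiv> totally_positive K (elt \<rho> x y z)"
abbreviation "N x y z \<equiv> field_norm K (elt \<rho> x y z)"

lemma elt_in_K: "elt \<rho> x y z \<in> K"
  using elt_in_int_adjoin int_adjoin_subset_rat_adjoin by blast

text \<open>The cubic is monic, so Horner's scheme never leaves the integer span of
  \<open>1\<close>, \<open>\<rho>\<close>, \<open>\<rho>^2\<close>.\<close>

lemma in_R_cases:
  assumes "\<alpha> \<in> R"
  obtains x y z where "\<alpha> = elt \<rho> x y z"
proof -
  obtain p where p: "\<alpha> = poly (map_poly of_int p) \<rho>" using assms by (auto simp: int_adjoin_def)
  have "\<exists>x y z. poly (map_poly of_int p) \<rho> = elt \<rho> x y z"
  proof (induction p)
    case 0
    have "poly (map_poly of_int 0) \<rho> = elt \<rho> 0 0 0" by (simp add: elt_def)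
    then show ?case by blast
  next
    case (pCons c p)
    then obtain x y z where xyz: "poly (map_poly of_int p) \<rho> = elt \<rho> x y z" by blast
    have "poly (map_poly of_int (pCons c p)) \<rho> = of_int c + \<rho> * elt \<rho> x y z"
      by (simp add: map_poly_pCons xyz)
    also have "\<dots> = elt \<rho> (c + z) (x + a * z) (y - (a - 1) * z)"
      unfolding elt_mult(1)[OF root] by (simp add: elt_def)
    finally show ?case by blast
  qed
  then show ?thesis using p that by auto
qed

section \<open>Conjugates, total positivity and norm in terms of the three real roots\<close>

definition min_poly :: "rat poly" where
  "min_poly = [:-1, - of_int a, of_int (a - 1), 1:]"

lemma rat_poly_min_poly: "rat_poly min_poly \<theta> = \<theta> * (\<theta> - 1) * (\<theta> + of_int a) - 1"
  by (simp add: min_poly_def algebra_simps of_rat_minus of_rat_diff)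

lemma irreducible_min_poly: "irreducible min_poly"
proof (rule irreducible_cubic)
  show "degree min_poly = 3" by (simp add: min_poly_def)
  show "poly min_poly x \<noteq> 0" for x
    using no_rational_root[of x a] by (simp add: min_poly_def algebra_simps)
qed

lemma bij_betw_embeddings:
  "bij_betw (\<lambda>\<sigma>. \<sigma> \<rho>) (field_embeddings K :: ('a \<Rightarrow> 'b::field_char_0) set)
    {\<theta>. \<theta> * (\<theta> - 1) * (\<theta> + of_int a) = 1}"
  using bij_betw_embeddings_roots[OF irreducible_min_poly, of \<rho>] root
  by (simp add: rat_poly_min_poly)

text \<open>Vieta's relations factor the cubic. Over the complex numbers this says that the field is
  totally real; the class \<open>real_field\<close> covers the reals as well.\<close>

lemma real_field_roots:
  "{\<theta> :: 'b::{real_field}. \<theta> * (\<theta> - 1) * (\<theta> + of_int a) = 1} = {of_real r, of_real s, of_real t}"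
proof -
  have "\<theta> * (\<theta> - 1) * (\<theta> + of_int a) - 1 = (\<theta> - of_real r) * (\<theta> - of_real s) * (\<theta> - of_real t)"
    for \<theta> :: 'b
  proof -
    have "(\<theta> - of_real r) * (\<theta> - of_real s) * (\<theta> - of_real t) =
      \<theta>^3 - of_real (r + s + t) * \<theta>^2 + of_real (r * s + r * t + s * t) * \<theta> - of_real (r * s * t)"
      by (simp add: algebra_simps power2_eq_square power3_eq_cube)
    also have "\<dots> = \<theta> * (\<theta> - 1) * (\<theta> + of_int a) - 1"
      unfolding vieta by (simp add: algebra_simps power2_eq_square power3_eq_cube)
    finally show ?thesis by (rule sym)
  qed
  then have "\<theta> * (\<theta> - 1) * (\<theta> + of_int a) = 1 \<longleftrightarrow> (\<theta> - of_real r) * (\<theta> - of_real s) * (\<theta> - of_real t) = 0"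
    for \<theta> :: 'b
    by (metis eq_iff_diff_eq_0)
  then show ?thesis by auto
qed

lemma tpos_iff: "tpos x y z \<longleftrightarrow> elt r x y z > 0 \<and> elt s x y z > 0 \<and> elt t x y z > 0"
proof -
  have img: "(\<lambda>\<sigma>. \<sigma> \<rho>) ` (field_embeddings K :: ('a \<Rightarrow> real) set) = {r, s, t}"
    using bij_betw_imp_surj_on[OF bij_betw_embeddings[where 'b = real]]
      real_field_roots[where 'b = real] by simp
  have "tpos x y z \<longleftrightarrow> (\<forall>\<theta> \<in> (\<lambda>\<sigma>. \<sigma> \<rho>) ` (field_embeddings K :: ('a \<Rightarrow> real) set). elt \<theta> x y z > 0)"
    using elt_in_K by (auto simp: totally_positive_def embedding_elt)
  then show ?thesis unfolding img by simp
qed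

lemma prod_embeddings_elt:
  "(\<Prod>\<sigma> \<in> (field_embeddings K :: ('a \<Rightarrow> complex) set). \<sigma> (elt \<rho> x y z)) =
    of_real (elt r x y z * elt s x y z * elt t x y z)"
proof -
  have "(\<Prod>\<sigma> \<in> (field_embeddings K :: ('a \<Rightarrow> complex) set). \<sigma> (elt \<rho> x y z)) =
      (\<Prod>\<sigma> \<in> (field_embeddings K :: ('a \<Rightarrow> complex) set). elt (\<sigma> \<rho>) x y z)"
    by (intro prod.cong) (simp_all add: embedding_elt)
  also have "\<dots> = (\<Prod>\<theta> \<in> {of_real r, of_real s, of_real t :: complex}. elt \<theta> x y z)"
    using prod.reindex_bij_betw[OF bij_betw_embeddings[where 'b = complex], of "\<lambda>\<theta>. elt \<theta> x y z"]
    unfolding real_field_roots .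
  \<comment> \<open>The bounds separate the three roots, so the product over the set has exactly
    three factors.\<close>
  also have "\<dots> = of_real (elt r x y z * elt s x y z * elt t x y z)"
    using bounds a_ge_3 by (simp add: elt_of_real)
  finally show ?thesis .
qed

lemma N_eqI:
  assumes "elt r x y z * elt s x y z * elt t x y z = of_int n"
  shows "N x y z = of_int n"
  using prod_embeddings_elt[of x y z] assms by (intro field_norm_eqI) simp

section \<open>Total positivity of the two cones\<close>

lemma root_bounds:
  assumes "\<theta> \<in> {r, s, t}"
  shows "\<theta>^2 > 0" "\<theta>^2 - \<theta> > 0" "\<theta> + of_int a > 0"
proof -
  have "\<theta> < 0 \<or> \<theta> > 1" using assms bounds a_ge_3 by auto
  then have "0 < \<theta> * (\<theta> - 1)" by (auto simp: zero_less_mult_iff)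
  then show "\<theta>^2 - \<theta> > 0" by (simp add: power2_eq_square right_diff_distrib)
  show "\<theta>^2 > 0" using \<open>\<theta> < 0 \<or> \<theta> > 1\<close> by auto
  show "\<theta> + of_int a > 0" using assms bounds a_ge_3 by auto
qed

text \<open>The elements \<open>1\<close>, \<open>\<rho>\<^sup>2 - \<rho>\<close>, \<open>\<rho>\<^sup>2\<close> generate the first cone; \<open>1\<close>, \<open>\<rho>\<^sup>2\<close> and
  \<open>1 + a\<rho> + \<rho>\<^sup>2 = \<rho>\<^sup>2(\<rho> + a)\<close> generate the second one.\<close>

lemma tpos_cone1:
  assumes "0 \<le> x" "y \<le> 0" "0 \<le> y + z" "x \<noteq> 0 \<or> y \<noteq> 0 \<or> z \<noteq> 0"
  shows "tpos x y z"
proof -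
  have "elt \<theta> x y z > 0" if "\<theta> \<in> {r, s, t}" for \<theta>
  proof -
    \<comment> \<open>These are the coordinates on the generators; the hypotheses say that they are
      nonnegative.\<close>
    have eq: "elt \<theta> x y z = of_int x + of_int (- y) * (\<theta>^2 - \<theta>) + of_int (y + z) * \<theta>^2"
      by (simp add: elt_def algebra_simps)
    have nonneg: "0 \<le> real_of_int (- y) * (\<theta>^2 - \<theta>)" "0 \<le> real_of_int (y + z) * \<theta>^2"
      using assms root_bounds[OF that] by (intro mult_nonneg_nonneg; linarith)+
    consider "x > 0" | "y < 0" | "y + z > 0" using assms by linarith
    then show ?thesis
    proof cases
      case 1
      then show ?thesis using eq nonneg by linarith
    next
      case 2
      then have "0 < real_of_int (- y) * (\<theta>^2 - \<theta>)"
        using root_bounds[OF that] by (intro mult_pos_pos) simp_all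
      then show ?thesis using eq nonneg assms(1) by linarith
    next
      case 3
      then have "0 < real_of_int (y + z) * \<theta>^2"
        using root_bounds[OF that] by (intro mult_pos_pos) linarith+
      then show ?thesis using eq nonneg assms(1) by linarith
    qed
  qed
  then show ?thesis by (simp add: tpos_iff)
qed

text \<open>This cone has index \<open>a\<close>, so coordinates on its generators have denominator
  \<open>a\<close>. Multiplied by \<open>a\<close> they are \<open>a * x - y\<close>,
  \<open>a * z - y\<close> and \<open>y\<close>.\<close>

lemma tpos_cone2:
  assumes "0 \<le> y" "y \<le> a * x" "y \<le> a * z" "x \<noteq> 0 \<or> y \<noteq> 0 \<or> z \<noteq> 0"
  shows "tpos x y z"
proof -
  have "elt \<theta> x y z > 0" if "\<theta> \<in> {r, s, t}" for \<theta>
  proof -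
    have eq: "of_int a * elt \<theta> x y z =
        of_int (a * x - y) + of_int (a * z - y) * \<theta>^2 + of_int y * (1 + of_int a * \<theta> + \<theta>^2)"
      by (simp add: elt_def algebra_simps)
    have "\<theta> * (\<theta> - 1) * (\<theta> + of_int a) = 1"
      using real_field_roots[where 'b = real] that by auto
    then have "1 + of_int a * \<theta> + \<theta>^2 = \<theta>^2 * (\<theta> + of_int a)"
      by (simp add: algebra_simps power2_eq_square)
    then have pos: "1 + of_int a * \<theta> + \<theta>^2 > 0" using root_bounds[OF that] by simp
    have nonneg: "0 \<le> real_of_int (a * z - y) * \<theta>^2" "0 \<le> real_of_int y * (1 + of_int a * \<theta> + \<theta>^2)"
      using assms(1-3) root_bounds[OF that] pos by (intro mult_nonneg_nonneg; linarith)+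
    have nonneg0: "0 \<le> real_of_int (a * x - y)" using assms(2) by (simp only: of_int_0_le_iff)
    have "a * x - y > 0 \<or> a * z - y > 0 \<or> y > 0"
    proof (rule ccontr)
      assume "\<not> ?thesis"
      then have "y = 0" "a * x = 0" "a * z = 0" using assms(1-3) by auto
      then show False using assms(4) a_ge_3 by simp
    qed
    then have "0 < of_int a * elt \<theta> x y z"
    proof (elim disjE)
      assume "a * x - y > 0"
      then have "real_of_int (a * x - y) > 0" by (simp only: of_int_0_less_iff)
      then show ?thesis using eq nonneg nonneg0 by linarith
    next
      assume "a * z - y > 0"
      then have "real_of_int (a * z - y) * \<theta>^2 > 0"
        using root_bounds[OF that] by (intro mult_pos_pos) (simp_all only: of_int_0_less_iff)
      then show ?thesis using eq nonneg nonneg0 by linarith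
    next
      assume "y > 0"
      then have "0 < real_of_int y * (1 + of_int a * \<theta> + \<theta>^2)" using pos by simp
      then show ?thesis using eq nonneg nonneg0 by linarith
    qed
    then show ?thesis using a_ge_3 by (simp add: zero_less_mult_iff)
  qed
  then show ?thesis by (simp add: tpos_iff)
qed

section \<open>Norms and indecomposables of the two cones\<close>

lemma indec_decompose:
  assumes "indec x y z" "tpos x' y' z'"
  shows "\<not> tpos (x - x') (y - y') (z - z')"
proof
  assume "tpos (x - x') (y - y') (z - z')"
  moreover have "elt \<rho> x y z = elt \<rho> x' y' z' + elt \<rho> (x - x') (y - y') (z - z')"
    by (simp flip: elt_diff)
  ultimately show False
    using assms elt_in_int_adjoin unfolding indecomposable_in_def by blast
qed

text \<open>The norm of \<open>1 + j * \<rho> + \<rho>^2\<close>; it is monic in \<open>j\<close>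
  because \<open>\<rho>\<close> has norm 1.\<close>

definition F :: "int \<Rightarrow> int" where
  "F j = j^3 + (1 - 2 * a) * j^2 + (a^2 - 3 * a - 2) * j + 2 * a^2 + 2 * a + 1"

lemma prod_elt_1_j_1: "elt r 1 j 1 * elt s 1 j 1 * elt t 1 j 1 = of_int (F j)"
proof -
  let ?e1 = "r + s + t" and ?e2 = "r * s + r * t + s * t" and ?e3 = "r * s * t"
  \<comment> \<open>Expansion in elementary symmetric functions of the roots. The part free of
    \<open>j\<close>, a sum of two squares, is the norm of \<open>1 + \<rho>^2\<close>.\<close>
  have "elt r 1 j 1 * elt s 1 j 1 * elt t 1 j 1 = ?e3 * of_int j^3 + (?e2 + ?e3 * ?e1) * of_int j^2 +
      (?e1 + ?e1 * ?e2 - 3 * ?e3 + ?e3 * ?e2) * of_int j + (1 - ?e2)^2 + (?e1 - ?e3)^2"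
    by (simp add: elt_def algebra_simps power2_eq_square power3_eq_cube)
  also have "\<dots> = of_int (F j)"
    unfolding vieta by (simp add: F_def algebra_simps power2_eq_square)
  finally show ?thesis .
qed

text \<open>Needed for the cone generators and for the units of the descent.\<close>

lemma prod_elt_unit:
  "elt r 1 a 1 * elt s 1 a 1 * elt t 1 a 1 = 1"
  "elt r a 1 0 * elt s a 1 0 * elt t a 1 0 = 1"
  "elt r 0 0 1 * elt s 0 0 1 * elt t 0 0 1 = 1"
  "elt r 0 (-1) 1 * elt s 0 (-1) 1 * elt t 0 (-1) 1 = 1"
proof -
  let ?e1 = "r + s + t" and ?e2 = "r * s + r * t + s * t" and ?e3 = "r * s * t"
  have "F a = 1" by (simp add: F_def algebra_simps power2_eq_square power3_eq_cube)
  then show "elt r 1 a 1 * elt s 1 a 1 * elt t 1 a 1 = 1" using prod_elt_1_j_1[of a] by simp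
  have "elt r a 1 0 * elt s a 1 0 * elt t a 1 0 = of_int a^3 + ?e1 * of_int a^2 + ?e2 * of_int a + ?e3"
    by (simp add: elt_def algebra_simps power2_eq_square power3_eq_cube)
  also have "\<dots> = 1" unfolding vieta by (simp add: algebra_simps power2_eq_square power3_eq_cube)
  finally show "elt r a 1 0 * elt s a 1 0 * elt t a 1 0 = 1" .
  have "elt r 0 0 1 * elt s 0 0 1 * elt t 0 0 1 = ?e3^2"
    by (simp add: elt_def algebra_simps power2_eq_square)
  then show "elt r 0 0 1 * elt s 0 0 1 * elt t 0 0 1 = 1" unfolding vieta by simp
  have "elt r 0 (-1) 1 * elt s 0 (-1) 1 * elt t 0 (-1) 1 = ?e3 * (?e3 - ?e2 + ?e1 - 1)"
    by (simp add: elt_def algebra_simps power2_eq_square)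
  then show "elt r 0 (-1) 1 * elt s 0 (-1) 1 * elt t 0 (-1) 1 = 1" unfolding vieta by simp
qed

text \<open>The cone is unimodular: subtracting a generator whose coordinate is positive leaves an
  element of the cone, which must be 0 by indecomposability. Hence the element is a
  generator.\<close>

lemma indec_cone1:
  assumes indec: "indec x y z" and cone: "0 \<le> x" "y \<le> 0" "0 \<le> y + z"
  shows "N x y z = 1"
proof -
  have nz: "\<not> (x = 0 \<and> y = 0 \<and> z = 0)"
    using indec tpos_iff[of x y z] by (auto simp: indecomposable_in_def elt_def)
  consider "x \<ge> 1" | "y + z \<ge> 1" | "y \<le> -1" using nz cone by linarith
  then have "(x, y, z) \<in> {(1, 0, 0), (0, 0, 1), (0, -1, 1)}"
  proof cases
    case 1
    have "\<not> tpos (x - 1) (y - 0) (z - 0)"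
      by (rule indec_decompose[OF indec]) (simp add: tpos_cone1)
    then have "x - 1 = 0 \<and> y = 0 \<and> z = 0" using tpos_cone1[of "x - 1" y z] cone 1 by auto
    then show ?thesis by simp
  next
    case 2
    have "\<not> tpos (x - 0) (y - 0) (z - 1)"
      by (rule indec_decompose[OF indec]) (simp add: tpos_cone1)
    then have "x = 0 \<and> y = 0 \<and> z - 1 = 0" using tpos_cone1[of x y "z - 1"] cone 2 by auto
    then show ?thesis by simp
  next
    case 3
    have "\<not> tpos (x - 0) (y - (-1)) (z - 1)"
      by (rule indec_decompose[OF indec]) (simp add: tpos_cone1)
    then have "x = 0 \<and> y + 1 = 0 \<and> z - 1 = 0" using tpos_cone1[of x "y + 1" "z - 1"] cone 3 by auto
    then show ?thesis by simp
  qed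
  then have "elt r x y z * elt s x y z * elt t x y z = 1"
    using prod_elt_unit by (auto simp: elt_def)
  then show ?thesis using N_eqI[of x y z 1] by simp
qed

text \<open>On the face \<open>y = 0\<close> the first cone applies. Otherwise \<open>x\<close> and
  \<open>z\<close> are positive. For \<open>y \<ge> a\<close> the generator
  \<open>1 + a * \<rho> + \<rho>^2\<close> can be subtracted, and for \<open>y < a\<close> the
  element \<open>1 + y * \<rho> + \<rho>^2\<close>, which leaves a nonnegative combination of
  \<open>1\<close> and \<open>\<rho>^2\<close>. Indecomposability makes the remainder 0.\<close>

lemma indec_cone2:
  assumes indec: "indec x y z" and cone: "0 \<le> y" "y \<le> a * x" "y \<le> a * z"
  shows "N x y z = 1 \<or> (\<exists>j. 1 \<le> j \<and> j < a \<and> N x y z = of_int (F j))"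
proof (cases "y = 0")
  case True
  then have "0 \<le> x" "0 \<le> z" using cone a_ge_3 by (simp_all add: zero_le_mult_iff)
  then show ?thesis using indec_cone1[OF indec] True by simp
next
  case False
  then have "0 < a * x" "0 < a * z" using cone by linarith+
  then have xz: "x \<ge> 1" "z \<ge> 1" using a_ge_3 by (simp_all add: zero_less_mult_iff)
  show ?thesis
  proof (cases "y \<ge> a")
    case True
    have "tpos 1 a 1" using a_ge_3 by (intro tpos_cone2) simp_all
    from indec_decompose[OF indec this]
    have "x - 1 = 0 \<and> y - a = 0 \<and> z - 1 = 0"
      using tpos_cone2[of "y - a" "x - 1" "z - 1"] cone True by (auto simp: algebra_simps)
    then have "elt r x y z * elt s x y z * elt t x y z = 1" using prod_elt_unit by auto
    then show ?thesis using N_eqI[of x y z 1] by simp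
  next
    case y: False
    have "tpos 1 y 1" using y cone a_ge_3 by (intro tpos_cone2) simp_all
    from indec_decompose[OF indec this]
    have "x - 1 = 0 \<and> z - 1 = 0"
      using tpos_cone1[of "x - 1" 0 "z - 1"] xz by auto
    then have "elt r x y z * elt s x y z * elt t x y z = of_int (F y)"
      using prod_elt_1_j_1[of y] by simp
    then have "N x y z = of_int (F y)" by (rule N_eqI)
    moreover have "1 \<le> y" "y < a" using y cone False by auto
    ultimately show ?thesis by blast
  qed
qed

subsection \<open>Descent to the two cones\<close>

text \<open>Both functionals are traces against totally positive elements of the codifferent; the
  coefficients below come from Lagrange interpolation at the three roots.\<close>

lemma tpos_functionals:
  assumes "tpos x y z"
  shows "0 < x + z" "0 < a * (x + z) - y"
proof -
  have pos: "elt r x y z > 0" "elt s x y z > 0" "elt t x y z > 0"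
    using assms by (simp_all add: tpos_iff)
  have t2: "t < -2" using bounds a_ge_3 by linarith
  \<comment> \<open>Since \<open>r * s * t = 1\<close>, the products \<open>s * t\<close> and
    \<open>r * s\<close> are the inverses of \<open>r\<close> and \<open>t\<close>.\<close>
  have st: "s * t > 1 / 2"
  proof (rule ccontr)
    assume "\<not> s * t > 1 / 2"
    moreover have "s * t > 0" using bounds t2 by (simp add: mult_neg_neg)
    ultimately have "r * (s * t) < 2 * (1 / 2)" using bounds by (intro mult_less_le_imp_less) auto
    then show False using vieta(3) by (simp add: mult.assoc)
  qed
  have rt: "r * t < -2"
    using mult_strict_mono'[of 1 r 2 "- t"] bounds t2 by simp
  have rs: "r * s > -1"
  proof (rule ccontr)
    assume "\<not> r * s > -1"
    then have "1 * 2 \<le> - (r * s) * - t" using t2 by (intro mult_mono) auto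
    then show False using vieta(3) by simp
  qed
  \<comment> \<open>The Vandermonde product of \<open>t < s < r\<close> clears the denominators of
    Lagrange interpolation.\<close>
  let ?D = "(r - s) * (r - t) * (s - t)"
  have diffs: "r - s > 0" "r - t > 0" "s - t > 0" using bounds t2 by linarith+
  then have D: "?D > 0" by simp
  \<comment> \<open>In each weight the product of the other two roots extracts \<open>x\<close> and
    the summand 1 extracts \<open>z\<close>.\<close>
  have "?D * (of_int x + of_int z) = elt r x y z * ((1 + s * t) * (s - t)) +
      elt s x y z * (- (1 + r * t) * (r - t)) + elt t x y z * ((1 + r * s) * (r - s))"
    by (simp add: elt_def algebra_simps power2_eq_square)
  moreover have "elt r x y z * ((1 + s * t) * (s - t)) > 0"
    "elt s x y z * (- (1 + r * t) * (r - t)) > 0" "elt t x y z * ((1 + r * s) * (r - s)) > 0"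
    using pos diffs st rt rs by (intro mult_pos_pos; linarith)+
  ultimately have "?D * (of_int x + of_int z) > 0" by linarith
  then have "real_of_int (x + z) > 0" using D by (simp add: zero_less_mult_iff)
  then show "0 < x + z" by (simp only: of_int_0_less_iff)
  let ?a = "real_of_int a"
  have a3: "?a \<ge> 3" using a_ge_3 by simp
  have c1: "?a * (1 + s * t) + (s + t) > 0"
  proof -
    \<comment> \<open>By Vieta \<open>a + s + t = 1 - r\<close>, which exceeds -1, so 3/2 for the
      remaining term suffices.\<close>
    have "?a * (s * t) \<ge> 3 * (1 / 2)" using a3 st by (intro mult_mono) auto
    then show ?thesis using vieta(1) bounds by (simp add: algebra_simps)
  qed
  have c2: "- (?a * (1 + r * t) + (r + t)) > 0"
  proof -
    have "?a * (1 + r * t) < 0" using a3 rt by (intro mult_pos_neg) linarith+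
    then show ?thesis using bounds t2 by linarith
  qed
  have c3: "?a * (1 + r * s) + (r + s) > 0"
  proof -
    have "?a * (1 + r * s) > 0" using a3 rs by (intro mult_pos_pos) linarith+
    then show ?thesis using bounds by linarith
  qed
  \<comment> \<open>Interpolation extracts \<open>y\<close> with minus the sum of the other two
    roots, hence the plus sign before that sum.\<close>
  have "?D * (?a * (of_int x + of_int z) - of_int y) =
      elt r x y z * ((?a * (1 + s * t) + (s + t)) * (s - t)) +
      elt s x y z * (- (?a * (1 + r * t) + (r + t)) * (r - t)) +
      elt t x y z * ((?a * (1 + r * s) + (r + s)) * (r - s))"
    by (simp add: elt_def algebra_simps power2_eq_square)
  moreover have "elt r x y z * ((?a * (1 + s * t) + (s + t)) * (s - t)) > 0"
    "elt s x y z * (- (?a * (1 + r * t) + (r + t)) * (r - t)) > 0"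
    "elt t x y z * ((?a * (1 + r * s) + (r + s)) * (r - s)) > 0"
    by (intro mult_pos_pos pos diffs c1 c2 c3)+
  ultimately have "?D * (?a * (of_int x + of_int z) - of_int y) > 0" by linarith
  then have "real_of_int (a * (x + z) - y) > 0" using D by (simp add: zero_less_mult_iff)
  then show "0 < a * (x + z) - y" by (simp only: of_int_0_less_iff)
qed

text \<open>The descent multiplies by a unit or by its inverse. The norm claim for \<open>v\<close>
  is the one for \<open>u\<close> read at \<open>v * \<alpha>\<close>.\<close>

lemma unit_invariance:
  assumes uv: "u \<in> R" "v \<in> R" "u * v = 1" and tp: "totally_positive K u"
    and norm: "(\<Prod>\<sigma> \<in> (field_embeddings K :: ('a \<Rightarrow> complex) set). \<sigma> u) = 1"
    and indec: "indecomposable_in K R \<alpha>"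
  shows "indecomposable_in K R (u * \<alpha>)" "field_norm K (u * \<alpha>) = field_norm K \<alpha>"
    "indecomposable_in K R (v * \<alpha>)" "field_norm K (v * \<alpha>) = field_norm K \<alpha>"
proof -
  have *: "field_norm K (u * \<beta>) = field_norm K \<beta>" if "\<beta> \<in> R" for \<beta>
    using uv that int_adjoin_subset_rat_adjoin norm by (intro field_norm_mult_unit) auto
  have \<alpha>: "\<alpha> \<in> R" using indec by (simp add: indecomposable_in_def)
  show "indecomposable_in K R (u * \<alpha>)"
    using indecomposable_in_mult_unit[OF indec uv(1) tp uv(2,3)] .
  show "field_norm K (u * \<alpha>) = field_norm K \<alpha>" using *[OF \<alpha>] .
  have "totally_positive K v"
    using totally_positive_inverse[OF tp _ uv(3)] uv(2) int_adjoin_subset_rat_adjoin by blast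
  then show "indecomposable_in K R (v * \<alpha>)"
    using indecomposable_in_mult_unit[OF indec uv(2) _ uv(1)] uv(3) by (simp add: mult.commute)
  have "u * (v * \<alpha>) = \<alpha>" using uv(3) by (metis mult.assoc mult_1_left)
  then show "field_norm K (v * \<alpha>) = field_norm K \<alpha>"
    using *[OF int_adjoin_mult[OF uv(2) \<alpha>]] by (simp only:)
qed

text \<open>The four moves of the descent in coordinates: \<open>\<rho> + a\<close>, then
  \<open>1 + a * \<rho> + \<rho>^2\<close>, then their inverses in the same order.\<close>

lemma indec_mult_units:
  assumes "indec x y z"
  shows "indec (a * x + z) (x + a * y + a * z) (y + z)"
    and "N (a * x + z) (x + a * y + a * z) (y + z) = N x y z"
    and "indec (x + y + z) (a * x + (a + 1) * (y + z)) (x + y + 2 * z)"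
    and "N (x + y + z) (a * x + (a + 1) * (y + z)) (x + y + 2 * z) = N x y z"
    and "indec (y - a * z) (a * y - x + (1 - a^2) * z) (x - a * y + a^2 * z)"
    and "N (y - a * z) (a * y - x + (1 - a^2) * z) (x - a * y + a^2 * z) = N x y z"
    and "indec (x - y + a * x) (y - z - (a - 1) * x) (z - x)"
    and "N (x - y + a * x) (y - z - (a - 1) * x) (z - x) = N x y z"
proof -
  have inv: "elt \<rho> a 1 0 * elt \<rho> 0 (-1) 1 = 1" "elt \<rho> 1 a 1 * elt \<rho> (1 + a) (1 - a) (-1) = 1"
    unfolding elt_mult[OF root] by (simp_all add: elt_def algebra_simps)
  have "tpos a 1 0" unfolding tpos_iff using root_bounds(3) by (simp add: elt_def add.commute)
  moreover have "tpos 1 a 1" using a_ge_3 by (intro tpos_cone2) simp_all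
  moreover have "(\<Prod>\<sigma> \<in> (field_embeddings K :: ('a \<Rightarrow> complex) set). \<sigma> (elt \<rho> a 1 0)) = 1"
    "(\<Prod>\<sigma> \<in> (field_embeddings K :: ('a \<Rightarrow> complex) set). \<sigma> (elt \<rho> 1 a 1)) = 1"
    unfolding prod_embeddings_elt prod_elt_unit by simp_all
  ultimately have
    u2: "indecomposable_in K R (elt \<rho> a 1 0 * elt \<rho> x y z)"
      "field_norm K (elt \<rho> a 1 0 * elt \<rho> x y z) = N x y z"
      "indecomposable_in K R (elt \<rho> 0 (-1) 1 * elt \<rho> x y z)"
      "field_norm K (elt \<rho> 0 (-1) 1 * elt \<rho> x y z) = N x y z"
    and u1: "indecomposable_in K R (elt \<rho> 1 a 1 * elt \<rho> x y z)"
      "field_norm K (elt \<rho> 1 a 1 * elt \<rho> x y z) = N x y z"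
      "indecomposable_in K R (elt \<rho> (1 + a) (1 - a) (-1) * elt \<rho> x y z)"
      "field_norm K (elt \<rho> (1 + a) (1 - a) (-1) * elt \<rho> x y z) = N x y z"
    using unit_invariance[OF elt_in_int_adjoin elt_in_int_adjoin inv(1) _ _ assms]
      unit_invariance[OF elt_in_int_adjoin elt_in_int_adjoin inv(2) _ _ assms] by blast+
  show "indec (a * x + z) (x + a * y + a * z) (y + z)"
    "N (a * x + z) (x + a * y + a * z) (y + z) = N x y z"
    "indec (x + y + z) (a * x + (a + 1) * (y + z)) (x + y + 2 * z)"
    "N (x + y + z) (a * x + (a + 1) * (y + z)) (x + y + 2 * z) = N x y z"
    "indec (y - a * z) (a * y - x + (1 - a^2) * z) (x - a * y + a^2 * z)"
    "N (y - a * z) (a * y - x + (1 - a^2) * z) (x - a * y + a^2 * z) = N x y z"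
    "indec (x - y + a * x) (y - z - (a - 1) * x) (z - x)"
    "N (x - y + a * x) (y - z - (a - 1) * x) (z - x) = N x y z"
    using u1 u2 unfolding elt_mult[OF root] by simp_all
qed

text \<open>Descent: each of the two functionals is \<open>1\<close> (up to the factor \<open>a\<close>) on the generators
  of its cone. If an element violates an inequality of its cone, then the functional of the
  neighbouring cone across the violated face has a smaller value.\<close>

lemma indec_norm:
  assumes "indec x y z"
  shows "N x y z = 1 \<or> (\<exists>j. 1 \<le> j \<and> j < a \<and> N x y z = of_int (F j))"
proof -
  \<comment> \<open>\<open>True\<close> stands for the first cone and \<open>False\<close> for the
    second. The factor \<open>a\<close> puts both functionals on one integer scale, with value
    \<open>a\<close> on all generators.\<close>
  define m where "m b x y z = (if b then a * (x + z) else a * (x + z) - y)" for b x y z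
  have "\<forall>x y z b. indec x y z \<longrightarrow> nat (m b x y z) = n \<longrightarrow>
    N x y z = 1 \<or> (\<exists>j. 1 \<le> j \<and> j < a \<and> N x y z = of_int (F j))" for n
  proof (induction n rule: less_induct)
    case (less n)
    show ?case
    proof (intro allI impI)
      fix x y z b
      assume indec: "indec x y z" and n: "nat (m b x y z) = n"
      let ?P = "\<lambda>q. q = 1 \<or> (\<exists>j. 1 \<le> j \<and> j < a \<and> q = of_int (F j))"
      \<comment> \<open>Positivity keeps \<open>nat\<close> from truncating, so a smaller value of
        \<open>m\<close> is a smaller induction parameter.\<close>
      have m_pos: "m b' x' y' z' > 0" if "indec x' y' z'" for b' x' y' z'
        using that tpos_functionals[of x' y' z'] a_ge_3
        by (auto simp: m_def indecomposable_in_def)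
      have step: "?P (N x y z)"
        if "indec x' y' z'" "N x' y' z' = N x y z" "m b' x' y' z' < m b x y z" for b' x' y' z'
      proof -
        have "nat (m b' x' y' z') < n" using that(3) n m_pos[OF indec, of b] by linarith
        then show ?thesis using less.IH that(1,2) by metis
      qed
      note units = indec_mult_units[OF indec]
      have a_pos: "a > 0" "a - 1 > 0" "a^2 - a - 1 > 0"
      proof -
        have "a * (a - 1) \<ge> 3 * 2" using a_ge_3 by (intro mult_mono) auto
        then show "a^2 - a - 1 > 0" by (simp add: power2_eq_square algebra_simps)
      qed (use a_ge_3 in auto)
      show "?P (N x y z)"
      proof (cases b)
        case True
        have m: "m b x y z = a * (x + z)" using True by (simp add: m_def)
        consider "y > 0" | "x < 0" | "y + z < 0" | "x \<ge> 0" "y \<le> 0" "y + z \<ge> 0" by linarith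
        then show ?thesis
        proof cases
          case 1
          \<comment> \<open>Both cones share the facet of \<open>1\<close> and
            \<open>\<rho>^2\<close>; crossing it only switches the functional.\<close>
          show ?thesis by (rule step[OF indec refl, of False]) (use 1 m in \<open>simp add: m_def\<close>)
        next
          case 2
          \<comment> \<open>The unit \<open>\<rho> + a\<close> carries the facet of
            \<open>\<rho>^2 - \<rho>\<close> and \<open>\<rho>^2\<close> to that of \<open>1\<close>
            and \<open>1 + a * \<rho> + \<rho>^2\<close>. The two functionals agree there, so their
            difference is a multiple of \<open>x\<close>.\<close>
          have "m False (a * x + z) (x + a * y + a * z) (y + z) - a * (x + z) = (a^2 - a - 1) * x"
            by (simp add: m_def algebra_simps power2_eq_square)
          moreover have "(a^2 - a - 1) * x < 0" using a_pos 2 by (simp add: mult_pos_neg)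
          ultimately show ?thesis using m by (intro step[OF units(1,2), of False]) linarith
        next
          case 3
          \<comment> \<open>Here \<open>1 + a * \<rho> + \<rho>^2\<close> carries the facet of
            \<open>1\<close> and \<open>\<rho>^2 - \<rho>\<close> to that of
            \<open>1 + a * \<rho> + \<rho>^2\<close> and \<open>\<rho>^2\<close>.\<close>
          have "m False (x + y + z) (a * x + (a + 1) * (y + z)) (x + y + 2 * z) - a * (x + z) =
              (a - 1) * (y + z)"
            by (simp add: m_def algebra_simps)
          moreover have "(a - 1) * (y + z) < 0" using a_pos 3 by (simp add: mult_pos_neg)
          ultimately show ?thesis using m by (intro step[OF units(3,4), of False]) linarith
        next
          case 4
          then show ?thesis using indec_cone1[OF indec] by blast
        qed
      next
        case False
        have m: "m b x y z = a * (x + z) - y" using False by (simp add: m_def)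
        consider "y < 0" | "a * x < y" | "a * z < y" | "0 \<le> y" "y \<le> a * x" "y \<le> a * z" by linarith
        then show ?thesis
        proof cases
          case 1
          show ?thesis by (rule step[OF indec refl, of True]) (use 1 m in \<open>simp add: m_def\<close>)
        next
          case 2
          \<comment> \<open>The inverse of \<open>1 + a * \<rho> + \<rho>^2\<close> leads back to
            the facet of \<open>1\<close> and \<open>\<rho>^2 - \<rho>\<close>.\<close>
          have "m True (x - y + a * x) (y - z - (a - 1) * x) (z - x) - (a * (x + z) - y) =
              (a - 1) * (a * x - y)"
            by (simp add: m_def algebra_simps)
          moreover have "(a - 1) * (a * x - y) < 0" using a_pos 2 by (simp add: mult_pos_neg)
          ultimately show ?thesis using m by (intro step[OF units(7,8), of True]) linarith
        next
          case 3
          \<comment> \<open>The inverse \<open>\<rho>^2 - \<rho>\<close> of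
            \<open>\<rho> + a\<close> leads back to the facet of \<open>\<rho>^2 - \<rho>\<close>
            and \<open>\<rho>^2\<close>.\<close>
          have "m True (y - a * z) (a * y - x + (1 - a^2) * z) (x - a * y + a^2 * z) -
              (a * (x + z) - y) = (a^2 - a - 1) * (a * z - y)"
            by (simp add: m_def algebra_simps power2_eq_square)
          moreover have "(a^2 - a - 1) * (a * z - y) < 0" using a_pos 3 by (simp add: mult_pos_neg)
          ultimately show ?thesis using m by (intro step[OF units(5,6), of True]) linarith
        next
          case 4
          then show ?thesis by (rule indec_cone2[OF indec])
        qed
      qed
    qed
  qed
  then show ?thesis using assms by blast
qed

end

section \<open>Maximising the norm polynomial over the integers\<close>

text \<open>The bound is the value at \<open>A - 1\<close>, so its difference from the cubic has the
  factor \<open>k = j - (A - 1)\<close>. It remains to compare the sign of the quadratic cofactor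
  with that of \<open>k\<close>.\<close>

lemma cubic_bound:
  fixes a A c j :: int
  assumes "a = 3 * A + c" "c \<in> {0, 1, 2}" "A \<ge> 1" "1 \<le> j" "j < a"
  shows "j^3 + (1 - 2 * a) * j^2 + (a^2 - 3 * a - 2) * j + 2 * a^2 + 2 * a + 1 \<le>
    (if c = 2 then 4 * A^3 + 18 * A^2 + 26 * A + 13
     else if c = 1 then 4 * A^3 + 14 * A^2 + 16 * A + 7
     else 4 * A^3 + 10 * A^2 + 8 * A + 3)" (is "?F \<le> ?B")
proof -
  \<comment> \<open>The maximum is attained at \<open>j = A - 1\<close>.\<close>
  define k where "k = j - (A - 1)"
  have j: "j = A - 1 + k" by (simp add: k_def)
  define p where "p = 3 * A + 2 + 2 * c"
  define q where "q = (2 * c - 1) * A + (c^2 + c - 1)"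
  define Q where "Q = k^2 - p * k + q"
  have c: "c = 0 \<or> c = 1 \<or> c = 2" using assms(2) by simp
  have "?B - ?F = - (k * Q)"
    using c unfolding assms(1) j Q_def p_def q_def
    by (elim disjE) (simp_all add: algebra_simps power2_eq_square power3_eq_cube)
  moreover have "k * Q \<le> 0"
  proof -
    \<comment> \<open>The first two facts say that \<open>Q\<close> is at most 0 at
      \<open>k = 1\<close> and positive at \<open>k = -1\<close>. Below, \<open>Q\<close> is written
      as its value there plus a product whose sign is clear; the third fact fixes that sign for
      \<open>k \<ge> 1\<close>.\<close>
    have pq: "q \<le> p - 1" "0 < p + q + 1" "k \<le> p - 1"
      using c assms by (auto simp: p_def q_def k_def)
    consider "k = 0" | "k \<ge> 1" | "k \<le> -1" by linarith
    then show ?thesis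
    proof cases
      case 2
      have "Q = (k - 1) * (k - (p - 1)) + (q - (p - 1))"
        by (simp add: Q_def algebra_simps power2_eq_square)
      moreover have "(k - 1) * (k - (p - 1)) \<le> 0"
        using 2 pq by (intro mult_nonneg_nonpos) auto
      ultimately have "Q \<le> 0" using pq by linarith
      then show ?thesis using 2 by (intro mult_nonneg_nonpos) auto
    next
      case 3
      have "Q = (k + 1) * (k - (p + 1)) + (p + q + 1)"
        by (simp add: Q_def algebra_simps power2_eq_square)
      moreover have "(k + 1) * (k - (p + 1)) \<ge> 0"
        using 3 c assms by (intro mult_nonpos_nonpos) (auto simp: p_def)
      ultimately have "Q \<ge> 0" using pq by linarith
      then show ?thesis using 3 by (intro mult_nonpos_nonneg) auto
    qed simp
  qed
  ultimately show ?thesis by linarith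
qed

theorem proposition4p3:
  fixes a :: int and A a\<^sub>0 :: nat and \<rho> \<alpha> :: "'a::field_char_0"
  assumes "a \<ge> 3"
    and "poly [:-1, - of_int a, of_int (a - 1), 1:] \<rho> = 0"
    and "a = 3 * int A + int a\<^sub>0" and "a\<^sub>0 \<in> {0, 1, 2}"
    and "indecomposable_in (rat_adjoin \<rho>) (int_adjoin \<rho>) \<alpha>"
  shows "field_norm (rat_adjoin \<rho>) \<alpha> \<le>
    (if a \<le> 4 then of_int (3 * a^2 - 3 * a + 1)
     else if a\<^sub>0 = 2 then of_nat (4 * A^3 + 18 * A^2 + 26 * A + 13)
     else if a\<^sub>0 = 1 then of_nat (4 * A^3 + 14 * A^2 + 16 * A + 7)
     else of_nat (4 * A^3 + 10 * A^2 + 8 * A + 3))"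
proof -
  define B where "B = (if a \<le> 4 then 3 * a^2 - 3 * a + 1
     else int (if a\<^sub>0 = 2 then 4 * A^3 + 18 * A^2 + 26 * A + 13
     else if a\<^sub>0 = 1 then 4 * A^3 + 14 * A^2 + 16 * A + 7
     else 4 * A^3 + 10 * A^2 + 8 * A + 3))"
  have "real_of_int a \<ge> 3" using assms(1) by simp
  then obtain r s t where rst: "1 < r" "r < 2" "-1 < s" "s < 0" "- real_of_int a < t" "t < 1 - real_of_int a"
    "r + s + t = 1 - real_of_int a" "r * s + r * t + s * t = - real_of_int a" "r * s * t = 1"
    by (rule real_roots)
  have "\<rho> * (\<rho> - 1) * (\<rho> + of_int a) = 1"
    using assms(2) by (simp add: algebra_simps)
  then interpret ennola a \<rho> r s t
    using assms(1) rst by unfold_locales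
  have F_le: "F j \<le> B" if j: "1 \<le> j" "j < a" for j
  proof (cases "a \<le> 4")
    case True
    \<comment> \<open>Here \<open>A = 1\<close>, so the maximiser \<open>A - 1 = 0\<close> lies
      outside the range of \<open>j\<close>, and the bound is
      \<open>F 1 = 3 * a^2 - 3 * a + 1\<close> instead.\<close>
    then have "a = 3 \<or> a = 4" using assms(1) by linarith
    then have "(a = 3 \<and> (j = 1 \<or> j = 2)) \<or> (a = 4 \<and> (j = 1 \<or> j = 2 \<or> j = 3))" using j by auto
    then show ?thesis by (auto simp: F_def B_def)
  next
    case False
    moreover have "int A \<ge> 1" using False assms(3,4) by auto
    ultimately show ?thesis
      using cubic_bound[OF assms(3), of j] assms(1,4) j by (auto simp: F_def B_def)
  qed
  have "1 \<le> B"
  proof (cases "a \<le> 4")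
    case True
    then have "a = 3 \<or> a = 4" using assms(1) by linarith
    then show ?thesis by (auto simp: B_def)
  qed (auto simp: B_def)
  have "\<alpha> \<in> R" using assms(5) by (simp add: indecomposable_in_def)
  then obtain x y z where \<alpha>: "\<alpha> = elt \<rho> x y z" by (rule in_R_cases)
  have "field_norm K \<alpha> = 1 \<or> (\<exists>j. 1 \<le> j \<and> j < a \<and> field_norm K \<alpha> = of_int (F j))"
    using indec_norm[of x y z] assms(5) unfolding \<alpha> by blast
  then have "field_norm K \<alpha> \<le> of_int B"
  proof
    assume "field_norm K \<alpha> = 1"
    then show ?thesis using \<open>1 \<le> B\<close> by simp
  next
    assume "\<exists>j. 1 \<le> j \<and> j < a \<and> field_norm K \<alpha> = of_int (F j)"
    then show ?thesis using F_le by (auto simp only: of_int_le_iff)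
  qed
  then show ?thesis by (simp add: B_def split: if_splits)
qed

end
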